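(* Let $A$ be an invertible $n\times n$ complex matrix. For (linearly) independent $x,y\in\mathbb C^n$ let $\Phi$ be the angle between the complex lines $\mathbb Cx$ and $\mathbb Cy$ and let $\Psi$ be the angle between the complex lines $\mathbb C(Ax)$ and $\mathbb C(Ay)$. Then \[ \kappa(A)^{-1}\tan(\Phi/2)\le\tan(\Psi/2)\le \kappa(A)\tan(\Phi/2). \]
   Context: $\|x\|=\sqrt{x^*x}$ is the Euclidean norm on $\mathbb C^n$. For non-zero $x,y\in\mathbb C^n$, the angle $\Theta$ between the complex lines $\mathbb Cx$ and $\mathbb Cy$ is given by $0\le\Theta\le\pi/2$ and $\cos\Theta=\dfrac{|y^*x|}{\|x\|\|y\|}$. The condition number is $\kappa(A)=\|A\|\,\|A^{-1}\|$, where $\|\cdot\|$ on matrices denotes the operator norm induced by the Euclidean norm. *)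

theory Defs
  imports "HOL-Analysis.Analysis"
begin

text \<open>\<open>herm_prod y x\<close> is $y^*x$, so it is conjugate-linear in its first argument. The library's inner
  product on \<^typ>\<open>complex ^ 'n\<close> is real-valued (the real part of this form), whereas the
  library's norm on this type already is $\sqrt{x^*x}$.\<close>

definition herm_prod :: "complex ^ 'n \<Rightarrow> complex ^ 'n \<Rightarrow> complex" where
  "herm_prod y x = (\<Sum>i\<in>UNIV. cnj (y $ i) * x $ i)"

lemma norm_eq_sqrt_herm_prod: "complex_of_real (norm x) = csqrt (herm_prod x x)"
proof -
  have "herm_prod x x = complex_of_real (\<Sum>i\<in>UNIV. (norm (x $ i))\<^sup>2)"
    unfolding herm_prod_def of_real_sum
    by (intro sum.cong refl) (metis complex_norm_square mult.commute)
  moreover have "0 \<le> (\<Sum>i\<in>UNIV. (norm (x $ i))\<^sup>2)"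
    by (intro sum_nonneg) simp
  ultimately show ?thesis
    by (simp only: norm_vec_def L2_set_def of_real_sqrt)
qed

text \<open>The angle between the complex lines spanned by non-zero \<open>x\<close> and \<open>y\<close>; the lemmas
  below show that it is the unique angle in $[0,\pi/2]$ with the prescribed cosine.
  For a zero vector the quotient is $0/0 = 0$ and the value is the meaningless $\pi/2$.\<close>

definition line_angle :: "complex ^ 'n \<Rightarrow> complex ^ 'n \<Rightarrow> real" where
  "line_angle x y = arccos (cmod (herm_prod y x) / (norm x * norm y))"

lemma cmod_herm_prod_le: "cmod (herm_prod y x) \<le> norm x * norm y"
proof -
  have "cmod (herm_prod y x) \<le> (\<Sum>i\<in>UNIV. \<bar>norm (y $ i)\<bar> * \<bar>norm (x $ i)\<bar>)"
    unfolding herm_prod_def by (rule order_trans[OF norm_sum]) (simp add: norm_mult)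
  also have "\<dots> \<le> norm y * norm x"
    unfolding norm_vec_def by (rule L2_set_mult_ineq)
  finally show ?thesis by (simp add: mult.commute)
qed

lemma line_angle_ratio:
  "0 \<le> cmod (herm_prod y x) / (norm x * norm y)"
  "cmod (herm_prod y x) / (norm x * norm y) \<le> 1"
  using cmod_herm_prod_le[of y x]
  by (simp, metis divide_le_eq_1_pos divide_eq_0_iff mult_nonneg_nonneg norm_ge_zero zero_le_one less_le)

lemma line_angle:
  "0 \<le> line_angle x y" "line_angle x y \<le> pi / 2"
  "cos (line_angle x y) = cmod (herm_prod y x) / (norm x * norm y)"
proof -
  note r = line_angle_ratio[of y x]
  then have m: "- 1 \<le> cmod (herm_prod y x) / (norm x * norm y)" by linarith
  show "0 \<le> line_angle x y"
    unfolding line_angle_def by (rule arccos_lbound[OF m r(2)])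
  show "line_angle x y \<le> pi / 2"
    unfolding line_angle_def by (rule arccos_le_pi2[OF r])
  show "cos (line_angle x y) = cmod (herm_prod y x) / (norm x * norm y)"
    unfolding line_angle_def by (rule cos_arccos[OF m r(2)])
qed

lemma line_angle_unique:
  assumes "0 \<le> t" "t \<le> pi / 2" "cos t = cmod (herm_prod y x) / (norm x * norm y)"
  shows "t = line_angle x y"
proof -
  have "t \<le> pi" using assms(1,2) by linarith
  with assms(1) show ?thesis unfolding line_angle_def assms(3)[symmetric] by (simp only: arccos_cos)
qed

definition condition_number :: "complex ^ 'n ^ 'n \<Rightarrow> real" where
  "condition_number A = onorm ((*v) A) * onorm ((*v) (matrix_inv A))"

end

theory Submission
  imports Defs
begin

text \<open>
  For all vectors \<open>a\<close> and \<open>b\<close> with angle \<open>\<theta>\<close> between their complex lines, the half-angle formula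
  $\tan^2(\theta/2) = (1-\cos\theta)/(1+\cos\theta)$ yields
  \[ \tan(\theta/2)\,\|a+b\| \le \|a-b\|, \]
  because $\mathrm{Re}(b^*a) \le \cos\theta\,\|a\|\|b\|$ and $2\|a\|\|b\| \le \|a\|^2+\|b\|^2$
  (\<open>tan_half_line_angle_le\<close>). Equality holds when $\|a\|=\|b\|$ and $b^*a \ge 0$
  (\<open>tan_half_line_angle_eq\<close>).

  The lines, and hence the angles, do not change when \<open>y\<close> is multiplied by a non-zero complex
  number, so \<open>y\<close> may be replaced by a multiple with $\|y\| = \|x\|$ and $y^*x \ge 0$.
  Equality then holds for \<open>x\<close> and \<open>y\<close>, while the inequality for \<open>A x\<close> and \<open>A y\<close> points in the right direction:
  \[ \tan(\Psi/2) \le \frac{\|A(x-y)\|}{\|A(x+y)\|}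
       \le \kappa(A)\,\frac{\|x-y\|}{\|x+y\|} = \kappa(A)\tan(\Phi/2). \]
  The lower bound is the upper bound for $A^{-1}$ and the vectors \<open>A x\<close> and \<open>A y\<close>.
\<close>

lemma inner_eq_Re_herm_prod: "x \<bullet> y = Re (herm_prod y x)"
  by (simp add: herm_prod_def inner_vec_def inner_complex_def algebra_simps)

lemma herm_prod_scale_left: "herm_prod (k *s y) x = cnj k * herm_prod y x"
  by (simp add: herm_prod_def sum_distrib_left mult.assoc)

lemma norm_vector_scalar_mult:
  fixes y :: "complex ^ 'n"
  shows "norm (k *s y) = cmod k * norm y"
proof -
  have "norm (k *s y) = L2_set (\<lambda>i. cmod k * cmod (y $ i)) UNIV"
    by (simp add: norm_vec_def norm_mult)
  then show ?thesis
    by (simp add: norm_vec_def L2_set_right_distrib)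
qed

lemma line_angle_scale_right:
  assumes "k \<noteq> 0"
  shows "line_angle x (k *s y) = line_angle x y"
  using assms
  by (simp add: line_angle_def herm_prod_scale_left norm_vector_scalar_mult norm_mult mult.left_commute)

lemma tan_half_nonneg:
  fixes t :: real
  assumes "0 \<le> t" "t \<le> pi / 2"
  shows "0 \<le> tan (t / 2)"
proof (cases "t = 0")
  case False
  then show ?thesis
    using assms tan_gt_zero[of "t / 2"] pi_gt_zero by linarith
qed simp

lemma tan_half_square:
  fixes t :: real
  assumes "0 \<le> cos t"
  shows "(tan (t / 2))\<^sup>2 = (1 - cos t) / (1 + cos t)"
proof -
  have "tan (t / 2) = sin t / (cos t + 1)"
    using tan_half[of "t / 2"] by simp
  moreover have "(sin t)\<^sup>2 = (1 - cos t) * (1 + cos t)"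
    by (simp add: sin_squared_eq power2_eq_square algebra_simps)
  ultimately show ?thesis
    using assms by (simp add: power_divide power2_eq_square add.commute)
qed

lemma inner_le_cos_line_angle:
  fixes a b :: "complex ^ 'n"
  shows "a \<bullet> b \<le> cos (line_angle a b) * (norm a * norm b)"
proof -
  have "a \<bullet> b \<le> cmod (herm_prod b a)"
    by (simp add: inner_eq_Re_herm_prod complex_Re_le_cmod)
  also have "\<dots> = cos (line_angle a b) * (norm a * norm b)"
    using cmod_herm_prod_le[of b a] by (auto simp: line_angle(3))
  finally show ?thesis .
qed

text \<open>
  No non-degeneracy is needed: if \<open>a\<close> or \<open>b\<close> is zero, then \<open>line_angle a b\<close> is $\pi/2$ and both
  sides agree.
\<close>

lemma tan_half_line_angle_le:
  fixes a b :: "complex ^ 'n"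
  shows "tan (line_angle a b / 2) * norm (a + b) \<le> norm (a - b)"
proof (rule power2_le_imp_le)
  let ?c = "cos (line_angle a b)"
  let ?s = "(norm a)\<^sup>2 + (norm b)\<^sup>2"
  have c: "0 \<le> ?c"
    unfolding line_angle(3) by (rule line_angle_ratio)
  have "2 * (norm a * norm b) \<le> ?s"
    using sum_squares_bound[of "norm a" "norm b"] by simp
  then have "?c * (2 * (norm a * norm b)) \<le> ?c * ?s"
    by (rule mult_left_mono[OF _ c])
  then have "2 * (a \<bullet> b) \<le> ?c * ?s"
    using inner_le_cos_line_angle[of a b] by linarith
  then have "(1 - ?c) * (?s + 2 * (a \<bullet> b)) \<le> (?s - 2 * (a \<bullet> b)) * (1 + ?c)"
    by (simp add: algebra_simps)
  then have "(1 - ?c) / (1 + ?c) * (?s + 2 * (a \<bullet> b)) \<le> ?s - 2 * (a \<bullet> b)"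
    using c by (simp add: pos_divide_le_eq)
  then show "(tan (line_angle a b / 2) * norm (a + b))\<^sup>2 \<le> (norm (a - b))\<^sup>2"
    by (simp add: power_mult_distrib tan_half_square[OF c] power2_norm_eq_inner
        inner_commute algebra_simps)
qed simp

text \<open>The assumption \<open>herm\<close> says that $b^*a$ is a non-negative real number.\<close>

lemma tan_half_line_angle_eq:
  fixes a b :: "complex ^ 'n"
  assumes eq: "norm a = norm b" and herm: "a \<bullet> b = cmod (herm_prod b a)"
  shows "tan (line_angle a b / 2) * norm (a + b) = norm (a - b)"
proof (rule power2_eq_imp_eq)
  let ?c = "cos (line_angle a b)"
  let ?s = "(norm a)\<^sup>2 + (norm b)\<^sup>2"
  have c: "0 \<le> ?c"
    unfolding line_angle(3) by (rule line_angle_ratio)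
  have "a \<bullet> b = ?c * (norm a * norm b)"
    using cmod_herm_prod_le[of b a] herm by (auto simp: line_angle(3))
  then have "2 * (a \<bullet> b) = ?c * ?s"
    using eq by (simp add: power2_eq_square)
  then have "(1 - ?c) * (?s + 2 * (a \<bullet> b)) = (?s - 2 * (a \<bullet> b)) * (1 + ?c)"
    by (simp add: algebra_simps)
  then have "(1 - ?c) / (1 + ?c) * (?s + 2 * (a \<bullet> b)) = ?s - 2 * (a \<bullet> b)"
    using c by (simp add: divide_eq_eq)
  then show "(tan (line_angle a b / 2) * norm (a + b))\<^sup>2 = (norm (a - b))\<^sup>2"
    by (simp add: power_mult_distrib tan_half_square[OF c] power2_norm_eq_inner
        inner_commute algebra_simps)
  show "0 \<le> tan (line_angle a b / 2) * norm (a + b)"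
    by (intro mult_nonneg_nonneg tan_half_nonneg line_angle norm_ge_zero)
qed simp

lemma exists_aligning_scalar:
  fixes x y :: "complex ^ 'n"
  assumes "x \<noteq> 0" "y \<noteq> 0"
  obtains k where "k \<noteq> 0" "norm x = norm (k *s y)" "x \<bullet> (k *s y) = cmod (herm_prod (k *s y) x)"
proof -
  let ?h = "herm_prod y x"
  \<comment> \<open>\<open>u\<close> cancels the phase of $y^*x$; if $y^*x = 0$, any phase will do\<close>
  define u where "u = (if ?h = 0 then 1 else sgn ?h)"
  define k where "k = complex_of_real (norm x / norm y) * u"
  have u: "cmod u = 1"
    by (simp add: u_def norm_sgn)
  have "cnj u * ?h = complex_of_real (cmod ?h)"
    by (simp add: u_def sgn_eq complex_norm_square[symmetric] mult.commute power2_eq_square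
        divide_simps flip: of_real_mult)
  then have "herm_prod (k *s y) x = complex_of_real (norm x / norm y * cmod ?h)"
    by (simp add: k_def herm_prod_scale_left mult.assoc)
  then have "x \<bullet> (k *s y) = cmod (herm_prod (k *s y) x)"
    by (simp only: inner_eq_Re_herm_prod Re_complex_of_real norm_of_real) simp
  moreover have "k \<noteq> 0"
    using assms u by (auto simp: k_def)
  moreover have "norm x = norm (k *s y)"
    using assms u by (simp add: k_def norm_vector_scalar_mult norm_mult norm_divide)
  ultimately show ?thesis
    using that by blast
qed

lemma matrix_inv_inverse:
  fixes A :: "'a::semiring_1 ^ 'n ^ 'm"
  assumes "invertible A"
  shows "A ** matrix_inv A = mat 1" "matrix_inv A ** A = mat 1"
proof -
  have "A ** matrix_inv A = mat 1 \<and> matrix_inv A ** A = mat 1"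
    using assms unfolding invertible_def matrix_inv_def by (rule someI_ex)
  then show "A ** matrix_inv A = mat 1" "matrix_inv A ** A = mat 1"
    by simp_all
qed

lemma invertible_matrix_inv:
  fixes A :: "'a::semiring_1 ^ 'n ^ 'm"
  assumes "invertible A"
  shows "invertible (matrix_inv A)"
  using matrix_inv_inverse[OF assms] by (auto simp: invertible_def)

lemma matrix_inv_matrix_inv:
  fixes A :: "'a::semiring_1 ^ 'n ^ 'm"
  assumes "invertible A"
  shows "matrix_inv (matrix_inv A) = A"
proof -
  let ?B = "matrix_inv A"
  have "matrix_inv ?B = (A ** ?B) ** matrix_inv ?B"
    by (simp only: matrix_inv_inverse[OF assms] matrix_mul_lid)
  also have "\<dots> = A ** (?B ** matrix_inv ?B)"
    by (simp only: matrix_mul_assoc)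
  also have "\<dots> = A"
    by (simp only: matrix_inv_inverse[OF invertible_matrix_inv[OF assms]] matrix_mul_rid)
  finally show ?thesis .
qed

lemma matrix_inv_mult_vector:
  fixes A :: "'a::semiring_1 ^ 'n ^ 'm"
  assumes "invertible A"
  shows "matrix_inv A *v (A *v x) = x" "A *v (matrix_inv A *v y) = y"
  by (simp_all add: matrix_vector_mul_assoc matrix_inv_inverse[OF assms])

lemma norm_matrix_vector_mult_le:
  fixes A :: "complex ^ 'n ^ 'm"
  shows "norm (A *v x) \<le> onorm ((*v) A) * norm x"
  by (rule onorm) simp

text \<open>
  Linear independence is expressed by saying that \<open>y\<close> is non-zero and \<open>x\<close> is not a multiple of
  \<open>y\<close>; the case $k = 0$ includes $x \ne 0$.
\<close>

lemma tan_half_line_angle_image_le: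
  fixes A :: "complex ^ 'n ^ 'n"
  assumes inv: "invertible A" and y: "y \<noteq> 0" and indep: "\<And>k. x \<noteq> k *s y"
  shows "tan (line_angle (A *v x) (A *v y) / 2) \<le> condition_number A * tan (line_angle x y / 2)"
proof -
  have "x \<noteq> 0"
    using indep[of 0] by simp
  then obtain k where k: "k \<noteq> 0" and aligned: "norm x = norm (k *s y)"
      "x \<bullet> (k *s y) = cmod (herm_prod (k *s y) x)"
    using exists_aligning_scalar y by blast
  define z where "z = k *s y"
  let ?tx = "tan (line_angle x y / 2)"
  let ?ta = "tan (line_angle (A *v x) (A *v y) / 2)"
  let ?N = "onorm ((*v) A)"
  let ?M = "onorm ((*v) (matrix_inv A))"
  have tx: "?tx * norm (x + z) = norm (x - z)"
    using tan_half_line_angle_eq[OF aligned] by (simp add: z_def line_angle_scale_right[OF k])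
  have "A *v z = k *s (A *v y)"
    by (simp add: z_def vector_scalar_commute)
  then have ta: "?ta * norm (A *v (x + z)) \<le> norm (A *v (x - z))"
    using tan_half_line_angle_le[of "A *v x" "A *v z"]
    by (simp add: line_angle_scale_right[OF k] matrix_vector_right_distrib matrix_vector_mult_diff_distrib)
  have "x + z \<noteq> 0"
    using indep[of "- k"] by (simp add: z_def eq_neg_iff_add_eq_0)
  then have pos: "0 < norm (A *v (x + z))"
    using matrix_inv_mult_vector(1)[OF inv, of "x + z"] by auto
  have N: "0 \<le> ?N"
    by (rule onorm_pos_le) simp
  have tx_nonneg: "0 \<le> ?tx"
    by (intro tan_half_nonneg line_angle)
  have "norm (x + z) \<le> ?M * norm (A *v (x + z))"
    using norm_matrix_vector_mult_le[of "matrix_inv A" "A *v (x + z)"]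
    by (simp only: matrix_inv_mult_vector(1)[OF inv])
  then have "?N * ?tx * norm (x + z) \<le> ?N * ?tx * (?M * norm (A *v (x + z)))"
    using N tx_nonneg by (intro mult_left_mono) simp_all
  moreover have "norm (A *v (x - z)) \<le> ?N * ?tx * norm (x + z)"
    using norm_matrix_vector_mult_le[of A "x - z"] tx by (simp add: mult.assoc)
  ultimately have "?ta * norm (A *v (x + z)) \<le> ?N * ?M * ?tx * norm (A *v (x + z))"
    using ta by (simp add: algebra_simps)
  then show ?thesis
    using pos by (simp add: condition_number_def)
qed

lemma condition_number_matrix_inv:
  fixes A :: "complex ^ 'n ^ 'n"
  assumes "invertible A"
  shows "condition_number (matrix_inv A) = condition_number A"
  using assms by (simp add: condition_number_def matrix_inv_matrix_inv mult.commute)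

lemma condition_number_pos:
  fixes A :: "complex ^ 'n ^ 'n"
  assumes "invertible A"
  shows "0 < condition_number A"
proof -
  have nonzero: "onorm ((*v) B) > 0" if "invertible B" for B :: "complex ^ 'n ^ 'n"
  proof -
    \<comment> \<open>\<open>1\<close> is the all-ones vector, used only as some non-zero vector\<close>
    have "B *v 1 \<noteq> 0"
      using matrix_inv_mult_vector(1)[OF that, of 1] by auto
    then show ?thesis
      by (subst onorm_pos_lt) auto
  qed
  show ?thesis
    using nonzero assms by (simp add: condition_number_def invertible_matrix_inv)
qed

theorem theorem3p2:
  fixes A :: "complex ^ 'n ^ 'n" and x y :: "complex ^ 'n" and \<Phi> \<Psi> :: real
  assumes "invertible A"
    and "x \<noteq> y" and "vec.independent {x, y}"
    and "\<Phi> = line_angle x y"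
    and "\<Psi> = line_angle (A *v x) (A *v y)"
  shows "inverse (condition_number A) * tan (\<Phi> / 2) \<le> tan (\<Psi> / 2) \<and>
         tan (\<Psi> / 2) \<le> condition_number A * tan (\<Phi> / 2)"
proof
  note inv = assms(1)
  let ?B = "matrix_inv A"
  have y: "y \<noteq> 0"
    using assms(3) vec.dependent_zero by blast
  have indep: "x \<noteq> k *s y" for k
    using assms(2,3) by (auto simp: vec.independent_insert vec.span_singleton)
  show "tan (\<Psi> / 2) \<le> condition_number A * tan (\<Phi> / 2)"
    unfolding assms(4,5) using inv y indep by (rule tan_half_line_angle_image_le)
  have invB: "invertible ?B"
    using inv by (rule invertible_matrix_inv)
  \<comment> \<open>\<open>A x\<close> and \<open>A y\<close> are again independent, and the inverse of \<open>A\<close> maps them to \<open>x\<close> and \<open>y\<close>\<close>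
  have "A *v y \<noteq> 0"
    using y matrix_inv_mult_vector(1)[OF inv, of y] by auto
  moreover have "A *v x \<noteq> k *s (A *v y)" for k
    using indep[of k] matrix_inv_mult_vector(1)[OF inv] by (metis vector_scalar_commute)
  ultimately have "tan (\<Phi> / 2) \<le> condition_number A * tan (\<Psi> / 2)"
    using tan_half_line_angle_image_le[OF invB, of "A *v y" "A *v x"]
    by (simp add: assms(4,5) matrix_inv_mult_vector[OF inv] condition_number_matrix_inv[OF inv])
  then show "inverse (condition_number A) * tan (\<Phi> / 2) \<le> tan (\<Psi> / 2)"
    using condition_number_pos[OF inv] by (simp add: field_simps)
qed

end
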